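(* Let $U_{0}\in CL(\mathbb{R}^{n+1})$ be such that $\{a\in\mathbb{R}^{n}:(a,b)\in U_{0}\text{ for some }b\in\mathbb{R}\}$ is bounded, and let $x_{0}\in\mathcal{F}(U_{0})$. Then $$\mathrm{lip}\,\mathcal{F}(U_{0},x_{0})=\frac{\|x_{0}\|+1}{d_{\ast}(0_{n},C_{U_{0}})},$$ where $$C_{U_{0}}:=\left\{u\in\mathbb{R}^{n}:(u,u^{\prime}x_{0})\in\mathrm{cl}\,\mathrm{conv}\,U_{0}\right\}.$$
   Context: $\mathbb{R}^{n}$ is equipped with an arbitrary norm $\|\cdot\|$, with dual norm $\|a\|_{\ast}=\sup_{\|x\|\le 1}a^{\prime}x$, where $a^{\prime}x$ is the usual inner product. $\mathbb{R}^{n+1}$, with elements written $(a,b)$, $a\in\mathbb{R}^{n}$, $b\in\mathbb{R}$, carries the norm $\|(a,b)\|=\max\{\|a\|_{\ast},|b|\}$. $CL(\mathbb{R}^{n+1})$ is the set of all nonempty closed subsets of $\mathbb{R}^{n+1}$, endowed with the extended Hausdorff distance $d_{H}(U_{1},U_{2})=\max\{e(U_{1},U_{2}),e(U_{2},U_{1})\}\in[0,+\infty]$, where $e(U_{i},U_{j})=\sup_{x\in U_{i}}d(x,U_{j})$ and $d(x,U_j)=\inf_{y\in U_j}\|x-y\|$. The feasible set mapping $\mathcal{F}:CL(\mathbb{R}^{n+1})\rightrightarrows\mathbb{R}^{n}$ is $\mathcal{F}(U)=\{x\in\mathbb{R}^{n}:a^{\prime}x\le b\text{ for all }(a,b)\in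 U\}$. For $x_{0}\in\mathcal{F}(U_{0})$, the Lipschitz modulus $\mathrm{lip}\,\mathcal{F}(U_{0},x_{0})$ is the infimum of all constants $\kappa\ge 0$ for which there exist neighborhoods $W$ of $x_{0}$ and $V$ of $U_{0}$ such that $d(x_{1},\mathcal{F}(U_{2}))\le\kappa\, d_{H}(U_{1},U_{2})$ for all $U_{1},U_{2}\in V$ and all $x_{1}\in\mathcal{F}(U_{1})\cap W$; it equals $+\infty$ if no such $\kappa$ exists. The distance from a point to the empty set is $+\infty$. $d_{\ast}(0_{n},C)=\inf_{u\in C}\|u\|_{\ast}$ (equal to $+\infty$ if $C=\emptyset$), $\mathrm{cl}\,\mathrm{conv}$ denotes the closed convex hull, and for a positive number $c$ the conventions $c/0=+\infty$ and $c/(+\infty)=0$ are used. *)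

theory Defs
  imports "HOL-Analysis.Analysis"
begin

text \<open>
  The space \<open>\<real>\<^sup>n\<close> is \<open>real ^ 'n\<close>. It carries an arbitrary norm \<open>N\<close>, passed around as a function,
  since the norm of the type class is the Euclidean one. All norms on a finite-dimensional space
  induce the same topology and the same bounded sets, so the library notions \<open>closed\<close>, \<open>closure\<close>,
  \<open>interior\<close> and \<open>bounded\<close> are used for these.
\<close>

definition is_norm :: "('a::real_vector \<Rightarrow> real) \<Rightarrow> bool" where
  "is_norm N \<longleftrightarrow>
     (\<forall>x. 0 \<le> N x) \<and> (\<forall>x. N x = 0 \<longleftrightarrow> x = 0) \<and>
     (\<forall>c x. N (c *\<^sub>R x) = \<bar>c\<bar> * N x) \<and> (\<forall>x y. N (x + y) \<le> N x + N y)"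

definition dual_norm :: "(real ^ 'n \<Rightarrow> real) \<Rightarrow> real ^ 'n \<Rightarrow> real" where
  "dual_norm N a = (SUP x\<in>{x. N x \<le> 1}. a \<bullet> x)"

definition data_norm :: "(real ^ 'n \<Rightarrow> real) \<Rightarrow> (real ^ 'n) \<times> real \<Rightarrow> real" where
  "data_norm N = (\<lambda>(a, b). max (dual_norm N a) \<bar>b\<bar>)"

text \<open>
  The library's \<open>infdist\<close> is real-valued and returns \<open>0\<close> for the empty set; here the infimum is taken
  in \<open>ereal\<close>, so that the distance to the empty set is \<open>\<infinity>\<close>.
\<close>

definition pt_dist :: "('a::real_vector \<Rightarrow> real) \<Rightarrow> 'a \<Rightarrow> 'a set \<Rightarrow> ereal" where
  "pt_dist N x S = (INF y\<in>S. ereal (N (x - y)))"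

definition excess :: "('a::real_vector \<Rightarrow> real) \<Rightarrow> 'a set \<Rightarrow> 'a set \<Rightarrow> ereal" where
  "excess N U1 U2 = (SUP x\<in>U1. pt_dist N x U2)"

definition haus_dist :: "('a::real_vector \<Rightarrow> real) \<Rightarrow> 'a set \<Rightarrow> 'a set \<Rightarrow> ereal" where
  "haus_dist N U1 U2 = max (excess N U1 U2) (excess N U2 U1)"

definition CL :: "'a::topological_space set set" where
  "CL = {U. U \<noteq> {} \<and> closed U}"

definition feasible :: "((real ^ 'n) \<times> real) set \<Rightarrow> (real ^ 'n) set" where
  "feasible U = {x. \<forall>(a, b)\<in>U. a \<bullet> x \<le> b}"

text \<open>Neighborhoods of \<open>U0\<close> in \<open>CL\<close> with respect to the extended metric \<open>haus_dist (data_norm N)\<close>.\<close>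

definition CL_nhd ::
    "(real ^ 'n \<Rightarrow> real) \<Rightarrow> ((real ^ 'n) \<times> real) set \<Rightarrow> ((real ^ 'n) \<times> real) set set \<Rightarrow> bool" where
  "CL_nhd N U0 V \<longleftrightarrow>
     V \<subseteq> CL \<and> (\<exists>\<epsilon>>0. {U \<in> CL. haus_dist (data_norm N) U0 U < ereal \<epsilon>} \<subseteq> V)"

text \<open>
  The infimum of the empty set of constants is \<open>\<infinity>\<close>. The \<open>ereal\<close> product \<open>0 * \<infinity> = 0\<close> does not influence
  the value, since \<open>V\<close> may always be shrunk to a set on which \<open>haus_dist\<close> is finite.
\<close>

definition lip_modulus ::
    "(real ^ 'n \<Rightarrow> real) \<Rightarrow> (((real ^ 'n) \<times> real) set \<Rightarrow> (real ^ 'n) set) \<Rightarrow>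
     ((real ^ 'n) \<times> real) set \<Rightarrow> real ^ 'n \<Rightarrow> ereal" where
  "lip_modulus N F U0 x0 =
     Inf {ereal \<kappa> | \<kappa>. 0 \<le> \<kappa> \<and>
       (\<exists>W V. x0 \<in> interior W \<and> CL_nhd N U0 V \<and>
         (\<forall>U1\<in>V. \<forall>U2\<in>V. \<forall>x1 \<in> F U1 \<inter> W.
            pt_dist N x1 (F U2) \<le> ereal \<kappa> * haus_dist (data_norm N) U1 U2))}"

definition C_set :: "((real ^ 'n) \<times> real) set \<Rightarrow> real ^ 'n \<Rightarrow> (real ^ 'n) set" where
  "C_set U0 x0 = {u. (u, u \<bullet> x0) \<in> closure (convex hull U0)}"

definition dual_dist0 :: "(real ^ 'n \<Rightarrow> real) \<Rightarrow> (real ^ 'n) set \<Rightarrow> ereal" where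
  "dual_dist0 N C = (INF u\<in>C. ereal (dual_norm N u))"

text \<open>
  For \<open>c > 0\<close>, division in \<open>ereal\<close> satisfies the two conventions used for the modulus formula.
\<close>

lemma ereal_pos_divide_conventions:
  fixes c :: real
  assumes "0 < c"
  shows "ereal c / 0 = \<infinity>" and "ereal c / \<infinity> = 0"
  using assms by (simp_all add: divide_ereal_def)

end

theory Submission
  imports Defs
begin

text \<open>
  The distance from a point \<open>x1\<close> to the solution set of a system of linear inequalities is governed
  by the ratios \<open>(a \<bullet> x1 - b) / dual_norm N a\<close>, where \<open>(a, b)\<close> ranges over the convex hull of the
  system.  The hull is essential: single inequalities bound the distance from below only, whereas
  separation of convex sets shows that a bound on all ratios over the hull produces a solution
  within that distance (\<open>solution_near_point\<close>).  With this formula both inequalities for the modulus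
  become computations with numerators and denominators.

  Numerator.  If \<open>x1\<close> solves \<open>U1\<close>, and \<open>U2\<close> has Hausdorff distance \<open>h\<close> from \<open>U1\<close>, then every
  \<open>(a, b)\<close> in the hull of \<open>U2\<close> is within \<open>h\<close> of an inequality that holds at \<open>x1\<close>, and so
  \<open>a \<bullet> x1 - b \<le> h * (N x1 + 1)\<close>.  This is the best bound, as the translation of the data in
  \<open>lipschitz_constant_lower_bound\<close> shows.

  Denominator.  Only the inequalities violated at \<open>x1\<close> matter.  When \<open>x1\<close> tends to \<open>x0\<close> and \<open>U2\<close> to
  \<open>U0\<close>, bounded sequences of such inequalities accumulate at elements of the closed convex hull of
  \<open>U0\<close> that are active at \<open>x0\<close>, that is at pairs \<open>(u, u \<bullet> x0)\<close> with \<open>u \<in> C_set U0 x0\<close>.  Hence in the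
  limit the denominators are at least \<open>dual_dist0 N (C_set U0 x0)\<close> (\<open>large_coefficients_stable\<close>).

  The extreme cases fit in: if \<open>C_set U0 x0\<close> is empty, the denominators tend to infinity and every
  positive constant is a Lipschitz constant; if it contains \<open>0\<close>, the lower bound on
  constants reads \<open>N x0 + 1 \<le> 0\<close>, so there are none.
\<close>

section \<open>Norms on a finite-dimensional space\<close>

context
  fixes N :: "'a::real_vector \<Rightarrow> real"
  assumes N: "is_norm N"
begin

lemma is_norm_nonneg: "0 \<le> N x"
  and is_norm_eq_0: "N x = 0 \<longleftrightarrow> x = 0"
  and is_norm_scale: "N (c *\<^sub>R x) = \<bar>c\<bar> * N x"
  and is_norm_triangle: "N (x + y) \<le> N x + N y"
  using N unfolding is_norm_def by auto

lemma is_norm_zero: "N 0 = 0"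
  using is_norm_eq_0 by blast

lemma is_norm_minus: "N (- x) = N x"
  using is_norm_scale[of "-1" x] by simp

lemma is_norm_minus_commute: "N (x - y) = N (y - x)"
  using is_norm_minus[of "x - y"] by simp

lemma is_norm_convex_comb:
  assumes "0 \<le> u" "0 \<le> v"
  shows "N (u *\<^sub>R x + v *\<^sub>R y) \<le> u * N x + v * N y"
  using is_norm_triangle[of "u *\<^sub>R x" "v *\<^sub>R y"] assms by (simp add: is_norm_scale)

end

lemma is_norm_upper_bound:
  fixes N :: "'a::euclidean_space \<Rightarrow> real"
  assumes N: "is_norm N"
  obtains K where "K > 0" "\<And>x. N x \<le> K * norm x"
proof
  let ?K = "(\<Sum>i\<in>Basis. N (i::'a)) + 1"
  show "?K > 0"
    using sum_nonneg[of Basis N] is_norm_nonneg[OF N] by (simp add: add_nonneg_pos)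
  fix x :: 'a
  have sum: "N (\<Sum>i\<in>S. f i) \<le> (\<Sum>i\<in>S. N (f i))" if "finite S" for S and f :: "'a \<Rightarrow> 'a"
    using that
  proof (induction S rule: finite_induct)
    case empty
    then show ?case by (simp add: is_norm_zero[OF N])
  next
    case (insert i S)
    then show ?case using is_norm_triangle[OF N, of "f i" "sum f S"] by simp
  qed
  have "N x = N (\<Sum>i\<in>Basis. (x \<bullet> i) *\<^sub>R i)"
    by (simp add: euclidean_representation)
  also have "\<dots> \<le> (\<Sum>i\<in>Basis. N ((x \<bullet> i) *\<^sub>R i))"
    by (rule sum) simp
  also have "\<dots> \<le> (\<Sum>i\<in>Basis. norm x * N i)"
    by (intro sum_mono) (simp add: is_norm_scale[OF N] mult_right_mono Basis_le_norm is_norm_nonneg[OF N])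
  also have "\<dots> = norm x * (\<Sum>i\<in>Basis. N i)"
    by (simp add: sum_distrib_left)
  also have "\<dots> \<le> ?K * norm x"
    by (simp add: algebra_simps)
  finally show "N x \<le> ?K * norm x" .
qed

lemma is_norm_continuous_on:
  fixes N :: "'a::euclidean_space \<Rightarrow> real"
  assumes N: "is_norm N"
  shows "continuous_on S N"
proof -
  obtain K where K: "K > 0" "\<And>x. N x \<le> K * norm x"
    using is_norm_upper_bound[OF N] by blast
  have "K-lipschitz_on S N"
  proof (rule lipschitz_onI)
    fix x y :: 'a
    have "N x \<le> N y + N (x - y)" "N y \<le> N x + N (y - x)"
      using is_norm_triangle[OF N, of y "x - y"] is_norm_triangle[OF N, of x "y - x"] by simp_all
    then show "dist (N x) (N y) \<le> K * dist x y"
      using K(2)[of "x - y"] is_norm_minus_commute[OF N, of x y] by (simp add: dist_norm)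
  qed (use K in simp)
  then show ?thesis by (rule lipschitz_on_continuous_on)
qed

text \<open>A norm is bounded away from zero on the compact Euclidean unit sphere.\<close>

lemma is_norm_lower_bound:
  fixes N :: "'a::euclidean_space \<Rightarrow> real"
  assumes N: "is_norm N"
  obtains c where "c > 0" "\<And>x. c * norm x \<le> N x"
proof -
  have "\<exists>z\<in>sphere 0 1. \<forall>y\<in>sphere (0::'a) 1. N z \<le> N y"
    by (rule continuous_attains_inf)
      (auto intro: is_norm_continuous_on[OF N])
  then obtain z where z: "norm z = 1" "\<And>y. norm y = 1 \<Longrightarrow> N z \<le> N y"
    by auto
  have "N z > 0"
    using is_norm_nonneg[OF N, of z] is_norm_eq_0[OF N, of z] z(1) by fastforce
  moreover have "N z * norm x \<le> N x" for x
  proof (cases "x = 0")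
    case True
    then show ?thesis by (simp add: is_norm_zero[OF N])
  next
    case False
    then have "N z \<le> N ((1 / norm x) *\<^sub>R x)"
      by (intro z(2)) simp
    then show ?thesis
      using False by (simp add: is_norm_scale[OF N] field_simps)
  qed
  ultimately show ?thesis using that by blast
qed

section \<open>The dual norm and the norm of the data space\<close>

context
  fixes N :: "real ^ 'n \<Rightarrow> real"
  assumes N: "is_norm N"
begin

text \<open>The supremum defining the dual norm is finite because the unit ball of \<open>N\<close> is bounded.\<close>

lemma bdd_above_dual_norm: "bdd_above ((\<lambda>x. a \<bullet> x) ` {x. N x \<le> 1})"
proof -
  obtain c where c: "c > 0" "\<And>x. c * norm x \<le> N x"
    using is_norm_lower_bound[OF N] by blast
  have "a \<bullet> x \<le> norm a * (1 / c)" if "N x \<le> 1" for x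
  proof -
    have "norm x \<le> 1 / c"
      using c(1) order_trans[OF c(2) that] by (simp add: field_simps)
    then have "norm a * norm x \<le> norm a * (1 / c)"
      by (rule mult_left_mono) simp
    then show ?thesis
      using norm_cauchy_schwarz[of a x] by linarith
  qed
  then show ?thesis
    by (auto intro!: bdd_aboveI)
qed

lemma inner_le_dual_norm_of_unit: "N x \<le> 1 \<Longrightarrow> a \<bullet> x \<le> dual_norm N a"
  unfolding dual_norm_def by (rule cSUP_upper[OF _ bdd_above_dual_norm]) simp

lemma dual_norm_le:
  assumes "\<And>x. N x \<le> 1 \<Longrightarrow> a \<bullet> x \<le> B"
  shows "dual_norm N a \<le> B"
proof -
  have "0 \<in> {x. N x \<le> 1}" by (simp add: is_norm_zero[OF N])
  then show ?thesis
    unfolding dual_norm_def using assms by (intro cSUP_least) auto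
qed

lemma dual_norm_nonneg: "0 \<le> dual_norm N a"
  using inner_le_dual_norm_of_unit[of 0 a] by (simp add: is_norm_zero[OF N])

lemma inner_le_dual_norm: "a \<bullet> x \<le> dual_norm N a * N x"
proof (cases "x = 0")
  case True
  then show ?thesis by (simp add: is_norm_zero[OF N])
next
  case False
  then have pos: "N x > 0"
    using is_norm_nonneg[OF N, of x] is_norm_eq_0[OF N, of x] by linarith
  then have "a \<bullet> ((1 / N x) *\<^sub>R x) \<le> dual_norm N a"
    by (intro inner_le_dual_norm_of_unit) (simp add: is_norm_scale[OF N])
  then show ?thesis using pos by (simp add: field_simps)
qed

lemma dual_norm_scale_le: "dual_norm N (c *\<^sub>R a) \<le> \<bar>c\<bar> * dual_norm N a"
proof (rule dual_norm_le)
  fix x assume x: "N x \<le> 1"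
  have "c *\<^sub>R a \<bullet> x = \<bar>c\<bar> * (a \<bullet> (sgn c *\<^sub>R x))"
    by (auto simp: sgn_if)
  also have "\<dots> \<le> \<bar>c\<bar> * dual_norm N a"
  proof (intro mult_left_mono inner_le_dual_norm_of_unit)
    show "N (sgn c *\<^sub>R x) \<le> 1"
      using x by (auto simp: is_norm_scale[OF N] sgn_if)
  qed simp
  finally show "c *\<^sub>R a \<bullet> x \<le> \<bar>c\<bar> * dual_norm N a" .
qed

lemma is_norm_dual_norm: "is_norm (dual_norm N)"
  unfolding is_norm_def
proof (intro conjI allI)
  fix a b :: "real ^ 'n" and c :: real
  show "0 \<le> dual_norm N a" by (rule dual_norm_nonneg)
  show "dual_norm N (a + b) \<le> dual_norm N a + dual_norm N b"
    by (rule dual_norm_le)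
      (auto simp: inner_add_left intro!: add_mono inner_le_dual_norm_of_unit)
  have zero: "dual_norm N 0 = 0"
    using dual_norm_le[of 0 0] dual_norm_nonneg[of 0] by simp
  show "(dual_norm N a = 0) = (a = 0)"
    using zero inner_le_dual_norm[of a a] inner_ge_zero[of a]
    by (metis inner_eq_zero_iff mult_zero_left order_antisym)
  show "dual_norm N (c *\<^sub>R a) = \<bar>c\<bar> * dual_norm N a"
  proof (cases "c = 0")
    case True
    then show ?thesis by (simp add: zero)
  next
    case False
    have "dual_norm N a \<le> \<bar>1 / c\<bar> * dual_norm N (c *\<^sub>R a)"
      using dual_norm_scale_le[of "1 / c" "c *\<^sub>R a"] False by simp
    then have "\<bar>c\<bar> * dual_norm N a \<le> dual_norm N (c *\<^sub>R a)"
      using False by (simp add: field_simps)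
    then show ?thesis using dual_norm_scale_le[of c a] by linarith
  qed
qed

lemma is_norm_data_norm: "is_norm (data_norm N)"
proof -
  note D = is_norm_dual_norm
  have eq: "data_norm N p = max (dual_norm N (fst p)) \<bar>snd p\<bar>" for p
    by (simp add: data_norm_def case_prod_beta)
  show ?thesis
    unfolding is_norm_def eq
  proof (intro conjI allI)
    fix p q :: "(real ^ 'n) \<times> real" and c :: real
    show "0 \<le> max (dual_norm N (fst p)) \<bar>snd p\<bar>"
      by simp
    show "(max (dual_norm N (fst p)) \<bar>snd p\<bar> = 0) = (p = 0)"
      using is_norm_eq_0[OF D, of "fst p"] dual_norm_nonneg[of "fst p"]
      by (auto simp: prod_eq_iff max_def)
    show "max (dual_norm N (fst (c *\<^sub>R p))) \<bar>snd (c *\<^sub>R p)\<bar>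
        = \<bar>c\<bar> * max (dual_norm N (fst p)) \<bar>snd p\<bar>"
      by (simp add: is_norm_scale[OF D] abs_mult max_mult_distrib_left)
    show "max (dual_norm N (fst (p + q))) \<bar>snd (p + q)\<bar>
        \<le> max (dual_norm N (fst p)) \<bar>snd p\<bar> + max (dual_norm N (fst q)) \<bar>snd q\<bar>"
      using is_norm_triangle[OF D, of "fst p" "fst q"] by (auto simp: max_def)
  qed
qed

text \<open>
  The open ball of radius \<open>N x\<close> and the point \<open>x\<close> are separated by a hyperplane; its normal vector,
  scaled to dual norm \<open>1\<close>, attains the value \<open>N x\<close> at \<open>x\<close>.
\<close>

lemma norming_functional:
  obtains z where "dual_norm N z \<le> 1" "z \<bullet> x = N x"
proof (cases "x = 0")
  case True
  then show ?thesis
    using that[of 0] is_norm_zero[OF N] is_norm_zero[OF is_norm_dual_norm] by simp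
next
  case False
  then have pos: "N x > 0"
    using is_norm_nonneg[OF N, of x] is_norm_eq_0[OF N, of x] by linarith
  let ?B = "{y. N y < N x}"
  have "convex ?B"
  proof (rule convexI)
    fix y w and s t :: real
    assume *: "y \<in> ?B" "w \<in> ?B" "0 \<le> s" "0 \<le> t" "s + t = 1"
    have "N (s *\<^sub>R y + t *\<^sub>R w) \<le> s * N y + t * N w"
      by (rule is_norm_convex_comb[OF N]) (use * in auto)
    also have "\<dots> < N x"
      by (rule convex_bound_lt) (use * in auto)
    finally show "s *\<^sub>R y + t *\<^sub>R w \<in> ?B" by simp
  qed
  moreover have "?B \<noteq> {}"
    using pos is_norm_zero[OF N] by (metis (mono_tags) empty_iff mem_Collect_eq)
  ultimately obtain u b where u: "u \<noteq> 0" "\<And>y. N y < N x \<Longrightarrow> u \<bullet> y \<le> b" "b \<le> u \<bullet> x"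
    using separating_hyperplane_sets[of ?B "{x}"] by auto
  have "dual_norm N u \<le> u \<bullet> x / N x"
  proof (rule dual_norm_le)
    fix y assume y: "N y \<le> 1"
    have "s * (u \<bullet> y) \<le> u \<bullet> x" if s: "0 < s" "s < N x" for s
    proof -
      have "N (s *\<^sub>R y) \<le> s * 1"
        using s y by (simp add: is_norm_scale[OF N])
      then show ?thesis using u(2)[of "s *\<^sub>R y"] u(3) s by simp
    qed
    \<comment> \<open>Radii \<open>s\<close> just below \<open>N x\<close> give the bound for the closed ball.\<close>
    then have "N x * (u \<bullet> y) \<le> u \<bullet> x"
      using pos
      by (intro tendsto_upperbound[of "\<lambda>s. s * (u \<bullet> y)" _ "at_left (N x)"])
        (auto intro!: tendsto_eq_intros eventually_at_leftI[of 0])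
    then show "u \<bullet> y \<le> u \<bullet> x / N x"
      using pos by (simp add: field_simps)
  qed
  then have le: "dual_norm N u * N x \<le> u \<bullet> x"
    using pos by (simp add: field_simps)
  have dpos: "dual_norm N u > 0"
    using u(1) dual_norm_nonneg[of u] is_norm_eq_0[OF is_norm_dual_norm, of u] by linarith
  show ?thesis
  proof (rule that)
    show "dual_norm N ((1 / dual_norm N u) *\<^sub>R u) \<le> 1"
      using dpos by (simp add: is_norm_scale[OF is_norm_dual_norm])
    show "((1 / dual_norm N u) *\<^sub>R u) \<bullet> x = N x"
      using le inner_le_dual_norm[of u x] dpos by (simp add: field_simps)
  qed
qed

section \<open>Distance to the solution set of a convex family of linear inequalities\<close>

text \<open>
  A pair \<open>(u, v)\<close> satisfies \<open>u \<bullet> x > v\<close> for all \<open>x\<close> in the ball of radius \<open>r\<close> around \<open>x1\<close> exactly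
  if it lies in the convex cone \<open>Q\<close> of the proof.  The assumption on \<open>D\<close> says that \<open>D\<close> misses \<open>Q\<close>.
  The normal vector of a hyperplane separating these two convex sets becomes, after its last
  coordinate is normalized to \<open>-1\<close>, a point \<open>z\<close> of \<open>\<real>\<^sup>n\<close>.  That the functional is nonnegative on \<open>Q\<close>
  puts \<open>z\<close> into the ball, by duality of the norms; that it is nonpositive on \<open>D\<close> makes \<open>z\<close> a solution.
\<close>

lemma solution_near_point:
  fixes D :: "((real ^ 'n) \<times> real) set"
  assumes D: "convex D" "D \<noteq> {}" and r: "0 \<le> r"
    and viol: "\<And>a b. (a, b) \<in> D \<Longrightarrow> a \<bullet> x1 - b \<le> r * dual_norm N a"
  obtains y where "N (y - x1) \<le> r" "\<And>a b. (a, b) \<in> D \<Longrightarrow> a \<bullet> y \<le> b"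
proof -
  note Dn = is_norm_dual_norm
  define Q where "Q = {(u, v). v < u \<bullet> x1 - r * dual_norm N u}"
  have "convex Q"
  proof (rule convexI; clarsimp simp: Q_def)
    fix u v u' v' and s t :: real
    assume *: "v < u \<bullet> x1 - r * dual_norm N u" "v' < u' \<bullet> x1 - r * dual_norm N u'"
      and st: "0 \<le> s" "0 \<le> t" "s + t = 1"
    have "r * dual_norm N (s *\<^sub>R u + t *\<^sub>R u') \<le> r * (s * dual_norm N u + t * dual_norm N u')"
      using is_norm_convex_comb[OF Dn st(1,2)] r by (intro mult_left_mono) auto
    moreover have "s * (v - (u \<bullet> x1 - r * dual_norm N u)) + t * (v' - (u' \<bullet> x1 - r * dual_norm N u')) < 0"
      by (rule convex_bound_lt) (use * st in auto)
    ultimately show "s * v + t * v' < (s *\<^sub>R u + t *\<^sub>R u') \<bullet> x1 - r * dual_norm N (s *\<^sub>R u + t *\<^sub>R u')"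
      by (simp add: inner_add_left algebra_simps)
  qed
  moreover have down: "(0, -1) \<in> Q"
    by (simp add: Q_def is_norm_zero[OF Dn])
  moreover have "D \<inter> Q = {}"
    using viol by (fastforce simp: Q_def)
  ultimately obtain w c where w: "w \<noteq> 0" "\<And>p. p \<in> D \<Longrightarrow> w \<bullet> p \<le> c" "\<And>q. q \<in> Q \<Longrightarrow> c \<le> w \<bullet> q"
    using separating_hyperplane_sets[of D Q] D by blast
  obtain y t where yt: "w = (y, t)" by (cases w)
  \<comment> \<open>Since \<open>Q\<close> is a cone, the separating functional is nonnegative on it and the level is at most \<open>0\<close>.\<close>
  have cone: "c \<le> s * (w \<bullet> q)" if "q \<in> Q" "s > 0" for s q
  proof -
    obtain u v where q: "q = (u, v)" by (cases q)
    have "s * v < s * (u \<bullet> x1 - r * dual_norm N u)"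
      using that by (intro mult_strict_left_mono) (simp_all add: Q_def q)
    then have "s *\<^sub>R q \<in> Q"
      using that(2) by (simp add: Q_def q is_norm_scale[OF Dn] algebra_simps)
    then have "c \<le> w \<bullet> (s *\<^sub>R q)" by (rule w(3))
    then show ?thesis by simp
  qed
  have nonneg: "0 \<le> w \<bullet> q" if "q \<in> Q" for q
  proof (rule ccontr)
    assume neg: "\<not> 0 \<le> w \<bullet> q"
    then have "c \<le> (\<bar>c\<bar> + 1) / - (w \<bullet> q) * (w \<bullet> q)"
      by (intro cone that) (simp add: field_simps)
    also have "\<dots> = - (\<bar>c\<bar> + 1)" using neg by simp
    finally show False by linarith
  qed
  have c: "c \<le> 0"
  proof (rule ccontr)
    assume pos: "\<not> c \<le> 0"
    have ge: "c \<le> w \<bullet> (0, -1)" using w(3) down .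
    then have "c \<le> c / (2 * (w \<bullet> (0, -1))) * (w \<bullet> (0, -1))"
      using pos by (intro cone down) simp
    also have "\<dots> = c / 2" using ge pos by simp
    finally show False using pos by simp
  qed
  have "t \<noteq> 0"
  proof
    assume t: "t = 0"
    have "(- y, - y \<bullet> x1 - r * dual_norm N (- y) - 1) \<in> Q" by (simp add: Q_def)
    from nonneg[OF this] have "y \<bullet> y \<le> 0"
      using t yt by simp
    then have "y = 0" by (metis inner_gt_zero_iff not_le)
    then show False using w(1) yt t by (simp add: zero_prod_def)
  qed
  moreover have "t \<le> 0" using nonneg[OF down] yt by simp
  ultimately have t: "t < 0" by simp
  define z where "z = (1 / - t) *\<^sub>R y"
  have y: "y = (- t) *\<^sub>R z" using t by (simp add: z_def)
  have "u \<bullet> x1 - r * dual_norm N u \<le> u \<bullet> z" for u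
  proof (rule dense_le)
    fix v assume "v < u \<bullet> x1 - r * dual_norm N u"
    then have "0 \<le> w \<bullet> (u, v)" by (intro nonneg) (simp add: Q_def)
    then have "(- t) * v \<le> (- t) * (u \<bullet> z)"
      by (simp add: yt y inner_commute mult.commute)
    then show "v \<le> u \<bullet> z" using t by simp
  qed
  from this[of "- u" for u] have dual: "u \<bullet> (z - x1) \<le> r * dual_norm N u" for u
    by (simp add: inner_diff_right is_norm_minus[OF Dn] algebra_simps)
  show ?thesis
  proof (rule that)
    obtain f where f: "dual_norm N f \<le> 1" "f \<bullet> (z - x1) = N (z - x1)"
      using norming_functional .
    then show "N (z - x1) \<le> r"
      using dual[of f] mult_left_mono[OF f(1) r] by simp
    fix a b assume "(a, b) \<in> D"
    from w(2)[OF this] c have "(- t) * (a \<bullet> z) \<le> (- t) * b"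
      by (simp add: yt y inner_commute mult.commute)
    then show "a \<bullet> z \<le> b" using t by simp
  qed
qed

end

section \<open>Hausdorff distance and convex hulls\<close>

lemma haus_dist_nonneg:
  assumes M: "is_norm M" and U: "U1 \<noteq> {}"
  shows "0 \<le> haus_dist M U1 U2"
proof -
  obtain x where "x \<in> U1" using U by blast
  then have "pt_dist M x U2 \<le> excess M U1 U2"
    unfolding excess_def by (rule SUP_upper)
  moreover have "0 \<le> pt_dist M x U2"
    unfolding pt_dist_def by (rule INF_greatest) (simp add: is_norm_nonneg[OF M])
  ultimately show ?thesis by (auto simp: haus_dist_def le_max_iff_disj)
qed

lemma haus_dist_lessD:
  assumes h: "haus_dist M U1 U2 < ereal h" and x: "x \<in> U2"
  obtains y where "y \<in> U1" "M (x - y) < h"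
proof -
  have "pt_dist M x U1 \<le> excess M U2 U1"
    unfolding excess_def using x by (rule SUP_upper)
  also have "\<dots> < ereal h"
    using h by (simp add: haus_dist_def)
  finally show ?thesis
    using that by (auto simp: pt_dist_def INF_less_iff)
qed

text \<open>
  Passing to convex hulls does not increase the Hausdorff distance: the points within distance
  \<open>h\<close> of a convex set form a convex set.
\<close>

lemma convex_hull_near:
  assumes M: "is_norm M" and h: "haus_dist M U1 U2 < ereal h" and p: "p \<in> convex hull U2"
  obtains q where "q \<in> convex hull U1" "M (p - q) \<le> h"
proof -
  let ?S = "{p. \<exists>q\<in>convex hull U1. M (p - q) \<le> h}"
  have "U2 \<subseteq> ?S"
  proof
    fix x assume "x \<in> U2"
    then obtain y where "y \<in> U1" "M (x - y) < h"
      using haus_dist_lessD[OF h] by blast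
    then show "x \<in> ?S"
      by (auto intro!: bexI[of _ y] less_imp_le hull_inc)
  qed
  moreover have "convex ?S"
  proof (rule convexI)
    fix x x' and s t :: real
    assume "x \<in> ?S" "x' \<in> ?S" and st: "0 \<le> s" "0 \<le> t" "s + t = 1"
    then obtain y y' where y: "y \<in> convex hull U1" "M (x - y) \<le> h"
      "y' \<in> convex hull U1" "M (x' - y') \<le> h" by blast
    have "(s *\<^sub>R x + t *\<^sub>R x') - (s *\<^sub>R y + t *\<^sub>R y') = s *\<^sub>R (x - y) + t *\<^sub>R (x' - y')"
      by (simp add: algebra_simps)
    then have "M ((s *\<^sub>R x + t *\<^sub>R x') - (s *\<^sub>R y + t *\<^sub>R y')) \<le> s * M (x - y) + t * M (x' - y')"
      using is_norm_convex_comb[OF M st(1,2), of "x - y" "x' - y'"] by simp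
    also have "\<dots> \<le> h"
      using y(2,4) st by (rule convex_bound_le)
    finally have "M ((s *\<^sub>R x + t *\<^sub>R x') - (s *\<^sub>R y + t *\<^sub>R y')) \<le> h" .
    moreover have "s *\<^sub>R y + t *\<^sub>R y' \<in> convex hull U1"
      using y(1,3) st by (rule convexD[OF convex_convex_hull])
    ultimately show "s *\<^sub>R x + t *\<^sub>R x' \<in> ?S" by blast
  qed
  ultimately have "convex hull U2 \<subseteq> ?S" by (rule hull_minimal)
  then show ?thesis using p that by blast
qed

lemma haus_dist_translation:
  assumes M: "is_norm M"
  shows "haus_dist M U ((+) v ` U) \<le> ereal (M v)"
proof -
  have "pt_dist M x ((+) v ` U) \<le> ereal (M v)" if "x \<in> U" for x
    unfolding pt_dist_def using that
    by (intro INF_lower2[of "v + x"]) (auto simp: is_norm_minus[OF M])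
  moreover have "pt_dist M x U \<le> ereal (M v)" if "x \<in> (+) v ` U" for x
    unfolding pt_dist_def using that
    by (intro INF_lower2[of "x - v"]) auto
  ultimately show ?thesis
    unfolding haus_dist_def excess_def by (simp add: SUP_least)
qed

lemma convex_hull_feasible:
  fixes U :: "((real ^ 'n) \<times> real) set"
  assumes x: "x \<in> feasible U" and p: "(a, b) \<in> closure (convex hull U)"
  shows "a \<bullet> x \<le> b"
proof -
  let ?H = "{p. (x, - 1) \<bullet> p \<le> (0::real)}"
  have "U \<subseteq> ?H"
    using x by (auto simp: feasible_def inner_commute)
  then have "convex hull U \<subseteq> ?H"
    by (rule hull_minimal) (rule convex_halfspace_le)
  then have "closure (convex hull U) \<subseteq> ?H"
    by (rule closure_minimal) (rule closed_halfspace_le)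
  then show ?thesis using p by (auto simp: inner_commute)
qed

section \<open>The upper estimate\<close>

context
  fixes N :: "real ^ 'n \<Rightarrow> real"
    and U0 :: "((real ^ 'n) \<times> real) set"
    and x0 :: "real ^ 'n"
  assumes N: "is_norm N" and x0: "x0 \<in> feasible U0"
begin

text \<open>
  An inequality in the closed convex hull with slack \<open>0\<close> at \<open>x0\<close> has its coefficient vector in
  the set \<open>C_set U0 x0\<close>, hence of dual norm greater than \<open>d\<close>.  Compactness makes this quantitative: an
  inequality whose slack at \<open>x0\<close> is at most some \<open>\<eta> > 0\<close> has dual norm greater than \<open>d + \<eta>\<close>.
\<close>

lemma slack_or_large_coefficients:
  assumes d: "ereal d < dual_dist0 N (C_set U0 x0)"
  obtains \<eta> where "\<eta> > 0"
    "\<And>a b. (a, b) \<in> convex hull U0 \<Longrightarrow> b - a \<bullet> x0 \<le> \<eta> \<Longrightarrow> d + \<eta> < dual_norm N a"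
proof -
  note Dn = is_norm_dual_norm[OF N]
  let ?K = "closure (convex hull U0)"
  \<comment> \<open>\<open>g p \<le> 0\<close> would put \<open>fst p\<close> into \<open>C_set U0 x0\<close> with dual norm at most \<open>d\<close>; so \<open>g\<close> is positive
    on the closed hull, and its sublevel sets there are compact.\<close>
  define g where "g p = max (snd p - fst p \<bullet> x0) (dual_norm N (fst p) - d)"
    for p :: "(real ^ 'n) \<times> real"
  have cont: "continuous_on S g" for S
    unfolding g_def
    by (intro continuous_intros continuous_on_compose2[OF is_norm_continuous_on[OF Dn, of UNIV]]) auto
  have g_pos: "0 < g p" if "p \<in> ?K" for p
  proof (rule ccontr)
    assume neg: "\<not> 0 < g p"
    obtain a b where p: "p = (a, b)" by (cases p)
    have "b = a \<bullet> x0"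
      using neg convex_hull_feasible[OF x0] that by (force simp: g_def p)
    then have "a \<in> C_set U0 x0" using that by (simp add: C_set_def p)
    then have "dual_dist0 N (C_set U0 x0) \<le> ereal (dual_norm N a)"
      unfolding dual_dist0_def by (rule INF_lower)
    moreover have "dual_norm N a \<le> d" using neg by (simp add: g_def p)
    ultimately show False using d by (meson ereal_less_eq(3) leD order_trans)
  qed
  let ?S = "{p \<in> ?K. g p \<le> 1}"
  obtain c where c: "c > 0" "\<And>a. c * norm a \<le> dual_norm N a"
    using is_norm_lower_bound[OF Dn] by blast
  have "compact ?S"
    unfolding compact_eq_bounded_closed
  proof
    have "?S = ?K \<inter> g -` {..1}" by auto
    then show "closed ?S"
      by (simp add: continuous_closed_preimage cont)
    let ?R = "(d + 1) / c"
    have "?S \<subseteq> cball 0 ?R \<times> {- (?R * norm x0)..1 + ?R * norm x0}"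
    proof clarify
      fix a b assume K: "(a, b) \<in> ?K" and "g (a, b) \<le> 1"
      then have g: "b - a \<bullet> x0 \<le> 1" "dual_norm N a \<le> d + 1" by (simp_all add: g_def)
      have a: "norm a \<le> ?R"
        using c(1) order_trans[OF c(2) g(2)] by (simp add: field_simps)
      have "\<bar>a \<bullet> x0\<bar> \<le> norm a * norm x0" by (rule Cauchy_Schwarz_ineq2)
      also have "\<dots> \<le> ?R * norm x0" using a by (rule mult_right_mono) simp
      finally have "\<bar>a \<bullet> x0\<bar> \<le> ?R * norm x0" .
      then have "b \<in> {- (?R * norm x0)..1 + ?R * norm x0}"
        using g(1) convex_hull_feasible[OF x0 K] unfolding atLeastAtMost_iff by linarith
      then show "a \<in> cball 0 ?R \<and> b \<in> {- (?R * norm x0)..1 + ?R * norm x0}"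
        using a by simp
    qed
    then show "bounded ?S"
      by (rule bounded_subset[rotated]) (intro bounded_Times bounded_cball bounded_closed_interval)
  qed
  obtain \<eta> where \<eta>: "\<eta> > 0" "\<And>p. p \<in> ?K \<Longrightarrow> \<eta> < g p"
  proof (cases "?S = {}")
    case True
    then show ?thesis using that[of 1] by fastforce
  next
    case False
    then obtain q where q: "q \<in> ?S" "\<And>p. p \<in> ?S \<Longrightarrow> g q \<le> g p"
      using continuous_attains_inf[OF \<open>compact ?S\<close> _ cont] by blast
    have pos: "0 < g q" using g_pos q(1) by blast
    show ?thesis
    proof (rule that[of "min 1 (g q / 2)"])
      fix p assume "p \<in> ?K"
      then show "min 1 (g q / 2) < g p"
        using q(2)[of p] pos by (cases "g p \<le> 1") auto
    qed (use pos in simp)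
  qed
  show ?thesis
  proof (rule that[OF \<eta>(1)])
    fix a b assume p: "(a, b) \<in> convex hull U0" and "b - a \<bullet> x0 \<le> \<eta>"
    then show "d + \<eta> < dual_norm N a"
      using \<eta>(2)[OF subsetD[OF closure_subset p]] by (simp add: g_def)
  qed
qed

text \<open>
  Stability of the preceding bound: an inequality of a perturbed convex hull that is active or
  violated near \<open>x0\<close> is close to an inequality of the original hull with small slack at \<open>x0\<close>.
\<close>

lemma large_coefficients_stable:
  assumes d: "ereal d < dual_dist0 N (C_set U0 x0)" and d0: "0 \<le> d"
  obtains \<epsilon> where "\<epsilon> > 0"
    "\<And>U a b x. haus_dist (data_norm N) U0 U < ereal \<epsilon> \<Longrightarrow> (a, b) \<in> convex hull U
      \<Longrightarrow> N (x - x0) \<le> \<epsilon> \<Longrightarrow> b \<le> a \<bullet> x \<Longrightarrow> d < dual_norm N a"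
proof -
  note Dn = is_norm_dual_norm[OF N]
  obtain \<eta> where \<eta>: "\<eta> > 0"
    "\<And>a b. (a, b) \<in> convex hull U0 \<Longrightarrow> b - a \<bullet> x0 \<le> \<eta> \<Longrightarrow> d + \<eta> < dual_norm N a"
    using slack_or_large_coefficients[OF d] by blast
  have Nx0: "0 \<le> N x0" by (rule is_norm_nonneg[OF N])
  \<comment> \<open>Errors in \<open>b\<close>, in \<open>x\<close> and in \<open>a\<close> contribute \<open>1\<close>, \<open>d\<close> and \<open>N x0\<close> times \<open>\<epsilon>\<close> to the slack.\<close>
  define \<epsilon> where "\<epsilon> = \<eta> / (1 + d + N x0)"
  have \<epsilon>: "\<epsilon> > 0" and \<epsilon>_eq: "\<epsilon> * (1 + d + N x0) = \<eta>"
    using \<eta>(1) d0 Nx0 by (auto simp: \<epsilon>_def field_simps add_pos_nonneg)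
  have "\<epsilon> * 1 \<le> \<epsilon> * (1 + d + N x0)"
    using \<epsilon> d0 Nx0 by (intro mult_left_mono) auto
  then have \<epsilon>_le: "\<epsilon> \<le> \<eta>" using \<epsilon>_eq by simp
  show ?thesis
  proof (rule that[OF \<epsilon>], rule ccontr)
    fix U a b x
    assume U: "haus_dist (data_norm N) U0 U < ereal \<epsilon>" and ab: "(a, b) \<in> convex hull U"
      and x: "N (x - x0) \<le> \<epsilon>" and act: "b \<le> a \<bullet> x" and "\<not> d < dual_norm N a"
    then have small: "dual_norm N a \<le> d" by simp
    obtain \<alpha> \<beta> where q: "(\<alpha>, \<beta>) \<in> convex hull U0" "data_norm N ((a, b) - (\<alpha>, \<beta>)) \<le> \<epsilon>"
      using convex_hull_near[OF is_norm_data_norm[OF N] U ab] by (metis surj_pair)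
    then have near: "dual_norm N (a - \<alpha>) \<le> \<epsilon>" "\<bar>b - \<beta>\<bar> \<le> \<epsilon>"
      by (simp_all add: data_norm_def)
    have "a \<bullet> (x - x0) \<le> dual_norm N a * N (x - x0)"
      by (rule inner_le_dual_norm[OF N])
    also have "\<dots> \<le> d * \<epsilon>"
      using small x d0 by (intro mult_mono) (auto intro: is_norm_nonneg[OF N])
    finally have 1: "a \<bullet> x - a \<bullet> x0 \<le> d * \<epsilon>" by (simp add: inner_diff_right)
    have "(a - \<alpha>) \<bullet> x0 \<le> dual_norm N (a - \<alpha>) * N x0"
      by (rule inner_le_dual_norm[OF N])
    also have "\<dots> \<le> \<epsilon> * N x0"
      using near(1) Nx0 by (rule mult_right_mono)
    finally have 2: "a \<bullet> x0 - \<alpha> \<bullet> x0 \<le> \<epsilon> * N x0" by (simp add: inner_diff_left)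
    have "\<beta> - \<alpha> \<bullet> x0 \<le> \<eta>"
      using 1 2 near(2) act \<epsilon>_eq by (simp add: algebra_simps)
    then have "d + \<eta> < dual_norm N \<alpha>" using \<eta>(2) q(1) by blast
    moreover have "dual_norm N \<alpha> \<le> dual_norm N a + dual_norm N (a - \<alpha>)"
      using is_norm_triangle[OF Dn, of a "\<alpha> - a"] is_norm_minus_commute[OF Dn, of a \<alpha>] by simp
    ultimately show False using near(1) small \<epsilon>_le by linarith
  qed
qed

text \<open>
  If \<open>x1\<close> solves the system \<open>U1\<close> at distance \<open>h\<close> from \<open>U2\<close>, then it violates an inequality of the
  convex hull of \<open>U2\<close> by at most \<open>h * (N x1 + 1)\<close>, whereas the violated inequalities have dual
  norm greater than \<open>d\<close>.
\<close>

lemma feasible_lipschitz_estimate: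
  assumes d: "ereal d < dual_dist0 N (C_set U0 x0)" "0 < d"
    and \<kappa>: "N x0 + 1 < \<kappa> * d"
  obtains \<epsilon> where "\<epsilon> > 0"
    "\<And>U1 U2 x1. U1 \<in> CL \<Longrightarrow> U2 \<in> CL \<Longrightarrow> haus_dist (data_norm N) U0 U2 < ereal \<epsilon>
      \<Longrightarrow> x1 \<in> feasible U1 \<Longrightarrow> N (x1 - x0) \<le> \<epsilon>
      \<Longrightarrow> pt_dist N x1 (feasible U2) \<le> ereal \<kappa> * haus_dist (data_norm N) U1 U2"
proof -
  note Mn = is_norm_data_norm[OF N]
  have \<kappa>_pos: "\<kappa> > 0"
    using \<kappa> d(2) is_norm_nonneg[OF N, of x0] by (smt (verit) mult_nonpos_nonneg)
  obtain \<epsilon>1 where \<epsilon>1: "\<epsilon>1 > 0"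
    "\<And>U a b x. haus_dist (data_norm N) U0 U < ereal \<epsilon>1 \<Longrightarrow> (a, b) \<in> convex hull U
      \<Longrightarrow> N (x - x0) \<le> \<epsilon>1 \<Longrightarrow> b \<le> a \<bullet> x \<Longrightarrow> d < dual_norm N a"
    using large_coefficients_stable[OF d(1)] d(2) by (metis less_imp_le)
  \<comment> \<open>The second bound keeps \<open>N x1 + 1 \<le> \<kappa> * d\<close> for \<open>x1\<close> within \<open>\<epsilon>\<close> of \<open>x0\<close>.\<close>
  define \<epsilon> where "\<epsilon> = min \<epsilon>1 (\<kappa> * d - (N x0 + 1))"
  show ?thesis
  proof (rule that[of \<epsilon>])
    show "\<epsilon> > 0" using \<epsilon>1(1) \<kappa> by (simp add: \<epsilon>_def)
    fix U1 U2 x1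
    assume U: "U1 \<in> CL" "U2 \<in> CL" and near: "haus_dist (data_norm N) U0 U2 < ereal \<epsilon>"
      and x1: "x1 \<in> feasible U1" "N (x1 - x0) \<le> \<epsilon>"
    have ne: "U1 \<noteq> {}" "U2 \<noteq> {}" using U by (auto simp: CL_def)
    have "N x1 \<le> N x0 + N (x1 - x0)"
      using is_norm_triangle[OF N, of x0 "x1 - x0"] by simp
    then have Nx1: "N x1 + 1 \<le> \<kappa> * d"
      using x1(2) by (simp add: \<epsilon>_def)
    show "pt_dist N x1 (feasible U2) \<le> ereal \<kappa> * haus_dist (data_norm N) U1 U2"
    proof (cases "haus_dist (data_norm N) U1 U2")
      case (real h)
      have h: "0 \<le> h" using haus_dist_nonneg[OF Mn ne(1), of U2] real by simp
      \<comment> \<open>The infima in the Hausdorff distance need not be attained, hence the radii \<open>h' > h\<close>.\<close>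
      have viol: "a \<bullet> x1 - b \<le> h * (N x1 + 1)" if ab: "(a, b) \<in> convex hull U2" for a b
      proof -
        have "(a \<bullet> x1 - b) / (N x1 + 1) \<le> h"
        proof (rule dense_ge)
          fix h' assume "h < h'"
          then have "haus_dist (data_norm N) U1 U2 < ereal h'" by (simp add: real)
          then obtain \<alpha> \<beta> where q: "(\<alpha>, \<beta>) \<in> convex hull U1"
            "data_norm N ((a, b) - (\<alpha>, \<beta>)) \<le> h'"
            using convex_hull_near[OF Mn _ ab] by (metis surj_pair)
          then have *: "dual_norm N (a - \<alpha>) \<le> h'" "\<bar>b - \<beta>\<bar> \<le> h'"
            by (simp_all add: data_norm_def)
          have "\<alpha> \<bullet> x1 \<le> \<beta>"
            by (rule convex_hull_feasible[OF x1(1) subsetD[OF closure_subset q(1)]])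
          moreover have "(a - \<alpha>) \<bullet> x1 \<le> h' * N x1"
            using inner_le_dual_norm[OF N, of "a - \<alpha>" x1]
              mult_right_mono[OF *(1) is_norm_nonneg[OF N, of x1]] by linarith
          ultimately have "a \<bullet> x1 - b \<le> h' * (N x1 + 1)"
            using *(2) by (simp add: algebra_simps)
          then show "(a \<bullet> x1 - b) / (N x1 + 1) \<le> h'"
            using is_norm_nonneg[OF N, of x1] by (simp add: divide_le_eq)
        qed
        then show ?thesis
          using is_norm_nonneg[OF N, of x1] by (simp add: divide_le_eq)
      qed
      have "a \<bullet> x1 - b \<le> \<kappa> * h * dual_norm N a" if ab: "(a, b) \<in> convex hull U2" for a b
      proof (cases "b \<le> a \<bullet> x1")
        case True
        have "d < dual_norm N a"
          using \<epsilon>1(2)[OF _ ab _ True] near x1(2) by (auto simp: \<epsilon>_def)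
        then have "\<kappa> * d \<le> \<kappa> * dual_norm N a" using \<kappa>_pos by simp
        then have "h * (N x1 + 1) \<le> h * (\<kappa> * dual_norm N a)"
          using Nx1 h by (intro mult_left_mono) auto
        then show ?thesis using viol[OF ab] by (simp add: mult_ac)
      next
        case False
        moreover have "0 \<le> \<kappa> * h * dual_norm N a"
          using \<kappa>_pos h dual_norm_nonneg[OF N] by simp
        ultimately show ?thesis by linarith
      qed
      then obtain y where y: "N (y - x1) \<le> \<kappa> * h" "\<And>a b. (a, b) \<in> convex hull U2 \<Longrightarrow> a \<bullet> y \<le> b"
        using solution_near_point[OF N, of "convex hull U2" "\<kappa> * h" x1] ne \<kappa>_pos h by auto
      have "y \<in> feasible U2"
        using y(2) by (auto simp: feasible_def intro: hull_inc)
      then have "pt_dist N x1 (feasible U2) \<le> ereal (N (x1 - y))"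
        unfolding pt_dist_def by (rule INF_lower)
      then show ?thesis
        using y(1) is_norm_minus_commute[OF N, of x1 y] by (simp add: real order_trans)
    next
      case PInf
      then show ?thesis using \<kappa>_pos by simp
    next
      case MInf
      then show ?thesis using haus_dist_nonneg[OF Mn ne(1), of U2] by simp
    qed
  qed
qed

section \<open>The lower estimate\<close>

text \<open>
  Choose \<open>z\<close> of dual norm at most \<open>1\<close> with \<open>z \<bullet> x0 = N x0\<close> and translate the data by
  \<open>(\<delta> z, - \<delta>)\<close>, a vector of norm at most \<open>\<delta>\<close>.  The implied inequality \<open>(u, u \<bullet> x0)\<close>, active at
  \<open>x0\<close>, becomes one that \<open>x0\<close> violates by \<open>\<delta> * (N x0 + 1)\<close>, with a coefficient vector of dual norm
  at most \<open>dual_norm N u + \<delta>\<close>.  So \<open>x0\<close> has distance at least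
  \<open>\<delta> * (N x0 + 1) / (dual_norm N u + \<delta>)\<close> from the new solution set, and \<open>\<delta>\<close> tends to \<open>0\<close>.
\<close>

lemma lipschitz_constant_lower_bound:
  assumes U0: "U0 \<in> CL" and \<kappa>: "0 \<le> \<kappa>"
    and W: "x0 \<in> W" and V: "CL_nhd N U0 V"
    and lip: "\<And>U1 U2 x1. U1 \<in> V \<Longrightarrow> U2 \<in> V \<Longrightarrow> x1 \<in> feasible U1 \<inter> W
      \<Longrightarrow> pt_dist N x1 (feasible U2) \<le> ereal \<kappa> * haus_dist (data_norm N) U1 U2"
    and u: "u \<in> C_set U0 x0"
  shows "N x0 + 1 \<le> \<kappa> * dual_norm N u"
proof -
  note Dn = is_norm_dual_norm[OF N] and Mn = is_norm_data_norm[OF N]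
  obtain \<epsilon> where \<epsilon>: "\<epsilon> > 0" "{U \<in> CL. haus_dist (data_norm N) U0 U < ereal \<epsilon>} \<subseteq> V"
    using V by (auto simp: CL_nhd_def)
  obtain z where z: "dual_norm N z \<le> 1" "z \<bullet> x0 = N x0"
    using norming_functional[OF N] .
  have step: "N x0 + 1 \<le> \<kappa> * (dual_norm N u + \<delta>)" if \<delta>: "0 < \<delta>" "\<delta> < \<epsilon>" for \<delta>
  proof -
    define v where "v = (\<delta> *\<^sub>R z, - \<delta>)"
    define U2 where "U2 = (+) v ` U0"
    have "dual_norm N (\<delta> *\<^sub>R z) \<le> \<delta>"
      using z(1) \<delta> mult_left_mono[OF z(1), of \<delta>] by (simp add: is_norm_scale[OF Dn])
    then have v: "data_norm N v \<le> \<delta>"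
      using \<delta> by (simp add: v_def data_norm_def)
    have haus: "haus_dist (data_norm N) U0 U2 \<le> ereal \<delta>"
      using haus_dist_translation[OF Mn, of U0 v] v unfolding U2_def
      by (meson ereal_less_eq(3) order_trans)
    have "U2 \<in> CL" using U0 by (auto simp: CL_def U2_def closed_translation)
    moreover have "haus_dist (data_norm N) U0 U2 < ereal \<epsilon>"
      using haus \<delta> by (meson ereal_less(2) le_less_trans less_ereal.simps(1))
    ultimately have U2: "U2 \<in> V" using \<epsilon>(2) by blast
    have "haus_dist (data_norm N) U0 U0 \<le> ereal (data_norm N 0)"
      using haus_dist_translation[OF Mn, of U0 0] by simp
    then have "haus_dist (data_norm N) U0 U0 < ereal \<epsilon>"
      using \<epsilon>(1) is_norm_zero[OF Mn] by (metis ereal_less_eq(3) less_ereal.simps(1) le_less_trans)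
    then have "U0 \<in> V" using \<epsilon>(2) U0 by blast
    then have "pt_dist N x0 (feasible U2) \<le> ereal \<kappa> * haus_dist (data_norm N) U0 U2"
      using lip[OF _ U2] x0 W by blast
    also have "\<dots> \<le> ereal \<kappa> * ereal \<delta>"
      using haus \<kappa> by (intro ereal_mult_left_mono) auto
    finally have upper: "pt_dist N x0 (feasible U2) \<le> ereal (\<kappa> * \<delta>)" by simp
    have hull: "(u + \<delta> *\<^sub>R z, u \<bullet> x0 - \<delta>) \<in> closure (convex hull U2)"
    proof -
      have "closure (convex hull U2) = (+) v ` closure (convex hull U0)"
        by (simp add: U2_def convex_hull_translation closure_translation)
      moreover have "(u, u \<bullet> x0) \<in> closure (convex hull U0)"
        using u by (simp add: C_set_def)
      ultimately show ?thesis
        by (metis (no_types, lifting) add.commute add_Pair diff_conv_add_uminus image_eqI v_def)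
    qed
    have dual: "dual_norm N (u + \<delta> *\<^sub>R z) \<le> dual_norm N u + \<delta>"
      using is_norm_triangle[OF Dn, of u "\<delta> *\<^sub>R z"] \<open>dual_norm N (\<delta> *\<^sub>R z) \<le> \<delta>\<close> by linarith
    have pos: "0 < dual_norm N u + \<delta>"
      using \<delta> dual_norm_nonneg[OF N, of u] by linarith
    have "ereal (\<delta> * (N x0 + 1) / (dual_norm N u + \<delta>)) \<le> pt_dist N x0 (feasible U2)"
      unfolding pt_dist_def
    proof (rule INF_greatest)
      fix y assume "y \<in> feasible U2"
      then have "(u + \<delta> *\<^sub>R z) \<bullet> y \<le> u \<bullet> x0 - \<delta>"
        using hull by (rule convex_hull_feasible)
      then have "\<delta> * (N x0 + 1) \<le> (u + \<delta> *\<^sub>R z) \<bullet> (x0 - y)"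
        using z(2) by (simp add: inner_diff_right inner_add_left algebra_simps)
      also have "\<dots> \<le> dual_norm N (u + \<delta> *\<^sub>R z) * N (x0 - y)"
        by (rule inner_le_dual_norm[OF N])
      also have "\<dots> \<le> (dual_norm N u + \<delta>) * N (x0 - y)"
        using dual is_norm_nonneg[OF N] by (rule mult_right_mono)
      finally show "ereal (\<delta> * (N x0 + 1) / (dual_norm N u + \<delta>)) \<le> ereal (N (x0 - y))"
        using pos by (simp add: divide_le_eq mult.commute)
    qed
    from order_trans[OF this upper]
    have "\<delta> * (N x0 + 1) \<le> \<delta> * (\<kappa> * (dual_norm N u + \<delta>))"
      using pos by (simp add: divide_le_eq mult_ac)
    then show ?thesis using \<delta> by simp
  qed
  show ?thesis
    using \<epsilon>(1)
    by (intro tendsto_lowerbound[of "\<lambda>\<delta>. \<kappa> * (dual_norm N u + \<delta>)" _ "at_right 0"])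
      (auto intro!: tendsto_eq_intros eventually_at_rightI[of 0 \<epsilon>] step)
qed

end

section \<open>The Lipschitz modulus\<close>

theorem theorem3p2:
  fixes N :: "real ^ 'n \<Rightarrow> real"
    and U0 :: "((real ^ 'n) \<times> real) set"
    and x0 :: "real ^ 'n"
  assumes "is_norm N"
    and "U0 \<in> CL"
    and "bounded {a. \<exists>b. (a, b) \<in> U0}"
    and "x0 \<in> feasible U0"
  shows "lip_modulus N feasible U0 x0 = ereal (N x0 + 1) / dual_dist0 N (C_set U0 x0)"
proof (rule antisym)
  note N = assms(1) and x0 = assms(4)
  let ?d = "dual_dist0 N (C_set U0 x0)"
  have R: "0 < N x0 + 1" using is_norm_nonneg[OF N, of x0] by linarith
  have d_nonneg: "0 \<le> ?d"
    unfolding dual_dist0_def by (rule INF_greatest) (simp add: dual_norm_nonneg[OF N])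
  show "lip_modulus N feasible U0 x0 \<le> ereal (N x0 + 1) / ?d"
  proof (rule dense_ge)
    fix k assume k: "ereal (N x0 + 1) / ?d < k"
    show "lip_modulus N feasible U0 x0 \<le> k"
    proof (cases k)
      case (real \<kappa>)
      have "0 \<le> ereal (N x0 + 1) / ?d"
        using R d_nonneg by (intro zero_le_divide_ereal) auto
      then have \<kappa>: "0 < \<kappa>"
        using k real by (metis ereal_less(2) le_less_trans)
      have "ereal ((N x0 + 1) / \<kappa>) < ?d"
        using k real R d_nonneg \<kappa>
        by (cases ?d) (auto simp: divide_ereal_def field_simps split: if_splits)
      then obtain d where R\<kappa>: "(N x0 + 1) / \<kappa> < d" and d: "ereal d < ?d"
        using ereal_dense2 by (metis less_ereal.simps(1))
      have d\<kappa>: "N x0 + 1 < \<kappa> * d"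
        using R\<kappa> \<kappa> by (simp add: divide_less_eq mult.commute)
      have "0 < (N x0 + 1) / \<kappa>" using R \<kappa> by simp
      then have "0 < d" using R\<kappa> by linarith
      obtain \<epsilon> where \<epsilon>: "\<epsilon> > 0"
        "\<And>U1 U2 x1. U1 \<in> CL \<Longrightarrow> U2 \<in> CL \<Longrightarrow> haus_dist (data_norm N) U0 U2 < ereal \<epsilon>
          \<Longrightarrow> x1 \<in> feasible U1 \<Longrightarrow> N (x1 - x0) \<le> \<epsilon>
          \<Longrightarrow> pt_dist N x1 (feasible U2) \<le> ereal \<kappa> * haus_dist (data_norm N) U1 U2"
        using feasible_lipschitz_estimate[OF N x0 d \<open>0 < d\<close> d\<kappa>] by blast
      obtain K where K: "K > 0" "\<And>x. N x \<le> K * norm x"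
        using is_norm_upper_bound[OF N] by blast
      let ?W = "ball x0 (\<epsilon> / K)" and ?V = "{U \<in> CL. haus_dist (data_norm N) U0 U < ereal \<epsilon>}"
      have "N (x - x0) \<le> \<epsilon>" if "x \<in> ?W" for x
        using K(2)[of "x - x0"] that K(1)
        by (simp add: dist_norm norm_minus_commute field_simps)
      then have "\<forall>U1\<in>?V. \<forall>U2\<in>?V. \<forall>x1\<in>feasible U1 \<inter> ?W.
          pt_dist N x1 (feasible U2) \<le> ereal \<kappa> * haus_dist (data_norm N) U1 U2"
        using \<epsilon>(2) by blast
      moreover have "x0 \<in> interior ?W" using \<epsilon>(1) K(1) by (simp add: interior_open)
      moreover have "CL_nhd N U0 ?V" using \<epsilon>(1) by (auto simp: CL_nhd_def)
      ultimately show ?thesis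
        unfolding lip_modulus_def real using \<kappa> less_imp_le
        by (intro Inf_lower) blast
    next
      case PInf
      then show ?thesis by simp
    next
      case MInf
      then show ?thesis using k by simp
    qed
  qed
  show "ereal (N x0 + 1) / ?d \<le> lip_modulus N feasible U0 x0"
    unfolding lip_modulus_def
  proof (rule Inf_greatest, clarsimp)
    fix \<kappa> W V
    assume \<kappa>: "0 \<le> \<kappa>" and W: "x0 \<in> interior W" and V: "CL_nhd N U0 V"
      and lip: "\<forall>U1\<in>V. \<forall>U2\<in>V. \<forall>x1\<in>feasible U1 \<inter> W.
        pt_dist N x1 (feasible U2) \<le> ereal \<kappa> * haus_dist (data_norm N) U1 U2"
    have *: "N x0 + 1 \<le> \<kappa> * dual_norm N u" if "u \<in> C_set U0 x0" for u
      using lipschitz_constant_lower_bound[OF N x0 assms(2) \<kappa> _ V _ that, of W]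
        W lip interior_subset by blast
    show "ereal (N x0 + 1) / ?d \<le> ereal \<kappa>"
    proof (cases "\<kappa> = 0")
      case True
      then have "C_set U0 x0 = {}" using * R by force
      then show ?thesis using \<kappa> by (simp add: dual_dist0_def top_ereal_def)
    next
      case False
      have "ereal ((N x0 + 1) / \<kappa>) \<le> ?d"
        unfolding dual_dist0_def
        by (rule INF_greatest) (use * \<kappa> False in \<open>simp add: divide_le_eq mult.commute\<close>)
      moreover have "0 < (N x0 + 1) / \<kappa>" using R \<kappa> False by simp
      ultimately show ?thesis
        using \<kappa> False R d_nonneg
        by (cases ?d) (auto simp: field_simps)
    qed
  qed
qed

end
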